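(* Let $\beta>0$, let $f:\mathbb{R}^2\to\mathbb{R}$ be $f(x)=\tfrac{\beta}{2}x_1^2$ where $x=(x_1,x_2)$, let $f^*$ be its conjugate function, and set $\sigma:=\tfrac1\beta$. Let the Douglas-Rachford algorithm be applied to minimize $f(x)+f^*(x)$, i.e. $$z^{k+1}=\big((1-\alpha)\mathrm{Id}+\alpha R_{\gamma A}R_{\gamma B}\big)z^k,\qquad A=\partial f^*,\quad B=\nabla f.$$ Suppose that $\gamma\in(0,\infty)$, that $\alpha\in[c,1)$ where $c=\frac{1+\gamma\sigma+\gamma^2\sigma\beta}{1+2\gamma\sigma+\gamma^2\sigma\beta}$, and that $z^0=(0,z_2^0)$ with $z_2^0\neq0$. Then the sequence $(z^k)$ converges exactly with rate $$\left|1-2\alpha+\alpha\frac{\frac{1}{\gamma\sigma}+\gamma\beta}{1+\frac{1}{\gamma\sigma}+\gamma\beta}\right|+\alpha\frac{\frac{1}{\gamma\sigma}+\gamma\beta}{1+\frac{1}{\gamma\sigma}+\gamma\beta}.$$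
   Context: $\mathbb{R}^2$ carries the Euclidean inner product. The conjugate is $f^*(y)=\sup_x\{\langle y,x\rangle-f(x)\}\in\mathbb{R}\cup\{\infty\}$, and $\partial$ denotes the convex subdifferential. For a maximally monotone operator $M$, the resolvent is $J_M=(\mathrm{Id}+M)^{-1}$ and the reflected resolvent is $R_M=2J_M-\mathrm{Id}$. Here $\nabla f$ is $\tfrac1\beta$-cocoercive and $\partial f^*$ is $\sigma$-strongly monotone with $\sigma=\tfrac1\beta$. "Converges exactly with rate $\rho$" means that $(z^k)$ converges to a fixed point $\bar z$ of the iteration operator $(1-\alpha)\mathrm{Id}+\alpha R_{\gamma A}R_{\gamma B}$ and $\|z^{k+1}-\bar z\|=\rho\|z^k-\bar z\|$ for all $k\ge0$. *)

theory Defs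
  imports "HOL-Analysis.Analysis"
begin

text \<open>Set-valued operators on a space are functions \<open>M :: 'a \<Rightarrow> 'a set\<close>.\<close>

definition conjugate :: "('a::real_inner \<Rightarrow> ereal) \<Rightarrow> 'a \<Rightarrow> ereal" where
  "conjugate f y = (SUP x. ereal (y \<bullet> x) - f x)"

text \<open>If \<open>g\<close> is proper and \<open>g x = \<infinity>\<close>, the inequality fails at any point of the effective
  domain of \<open>g\<close>, so \<open>subdifferential g x = {}\<close>, as usual.\<close>

definition subdifferential :: "('a::real_inner \<Rightarrow> ereal) \<Rightarrow> 'a \<Rightarrow> 'a set" where
  "subdifferential g x = {u. \<forall>y. g x + ereal (u \<bullet> (y - x)) \<le> g y}"

definition gradient :: "('a::real_inner \<Rightarrow> real) \<Rightarrow> 'a \<Rightarrow> 'a" where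
  "gradient f x = (THE D. GDERIV f x :> D)"

definition scale_op :: "real \<Rightarrow> ('a::real_vector \<Rightarrow> 'a set) \<Rightarrow> 'a \<Rightarrow> 'a set" where
  "scale_op c M x = (\<lambda>u. c *\<^sub>R u) ` M x"

definition id_plus_op :: "('a::real_vector \<Rightarrow> 'a set) \<Rightarrow> 'a \<Rightarrow> 'a set" where
  "id_plus_op M x = (\<lambda>u. x + u) ` M x"

definition inverse_op :: "('a \<Rightarrow> 'b set) \<Rightarrow> 'b \<Rightarrow> 'a set" where
  "inverse_op M y = {x. y \<in> M x}"

text \<open>For maximally monotone \<open>M\<close> on a Hilbert space, \<open>inverse_op (id_plus_op M) z\<close> is a singleton
  for every \<open>z\<close> (Minty), and the resolvent is read as a function; for other \<open>M\<close> the value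
  may be unspecified.\<close>

definition resolvent :: "('a::real_vector \<Rightarrow> 'a set) \<Rightarrow> 'a \<Rightarrow> 'a" where
  "resolvent M z = (THE p. p \<in> inverse_op (id_plus_op M) z)"

definition reflected_resolvent :: "('a::real_vector \<Rightarrow> 'a set) \<Rightarrow> 'a \<Rightarrow> 'a" where
  "reflected_resolvent M z = 2 *\<^sub>R resolvent M z - z"

definition DR_operator ::
    "real \<Rightarrow> real \<Rightarrow> ('a::real_vector \<Rightarrow> 'a set) \<Rightarrow> ('a \<Rightarrow> 'a set) \<Rightarrow> 'a \<Rightarrow> 'a" where
  "DR_operator \<alpha> \<gamma> A B z =
     (1 - \<alpha>) *\<^sub>R z +
     \<alpha> *\<^sub>R reflected_resolvent (scale_op \<gamma> A) (reflected_resolvent (scale_op \<gamma> B) z)"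

definition converges_exactly_with_rate ::
    "('a::real_normed_vector \<Rightarrow> 'a) \<Rightarrow> (nat \<Rightarrow> 'a) \<Rightarrow> real \<Rightarrow> bool" where
  "converges_exactly_with_rate T z \<rho> \<longleftrightarrow>
     (\<exists>zbar. T zbar = zbar \<and> z \<longlonglongrightarrow> zbar \<and>
        (\<forall>k. norm (z (Suc k) - zbar) = \<rho> * norm (z k - zbar)))"

end

theory Submission
  imports Defs
begin

text \<open>Everything is explicit for \<open>f x = \<beta>/2 x\<^sub>1\<^sup>2\<close>. The gradient of \<open>f\<close> is \<open>(\<beta> x\<^sub>1, 0)\<close>, so the
  reflected resolvent of \<open>\<gamma> \<nabla>f\<close> leaves the second coordinate unchanged. The conjugate of \<open>f\<close> is
  \<open>y\<^sub>1\<^sup>2 / (2\<beta>)\<close> on the axis \<open>y\<^sub>2 = 0\<close> and \<open>\<infinity>\<close> off it; the domain constraint makes the resolvent of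
  \<open>\<gamma> \<partial>f\<^sup>*\<close> kill the second coordinate, so that the reflected resolvent changes its sign
  (lemmas \<open>reflected_resolvent_gradient\<close> and \<open>reflected_resolvent_subdifferential_conjugate\<close>).
  Both act on the first coordinate by a scalar factor. Hence the Douglas-Rachford operator is
  linear and diagonal, and on the axis \<open>x\<^sub>1 = 0\<close> it is multiplication by \<open>1 - 2\<alpha>\<close>. The iterates
  tend to \<open>0\<close> with rate exactly \<open>\<bar>1 - 2\<alpha>\<bar>\<close>.

  Put \<open>q = (1/(\<gamma>\<sigma>) + \<gamma>\<beta>) / (1 + 1/(\<gamma>\<sigma>) + \<gamma>\<beta>)\<close>. Then \<open>c = 1 / (2 - q)\<close> with \<open>0 < q < 1\<close>, so
  \<open>\<alpha> \<ge> c\<close> says that \<open>1 - 2\<alpha> + \<alpha>q \<le> 0\<close>. The claimed rate therefore equals \<open>2\<alpha> - 1\<close>, which is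
  \<open>\<bar>1 - 2\<alpha>\<bar>\<close> because \<open>\<alpha> > 1/2\<close>.\<close>

lemma vec2_eq_iff: "x = y \<longleftrightarrow> x $ 1 = y $ 1 \<and> x $ 2 = y $ 2" for x y :: "'a ^ 2"
  by (simp add: vec_eq_iff forall_2)

lemma inner_vec2: "x \<bullet> y = x $ 1 * y $ 1 + x $ 2 * y $ 2" for x y :: "real ^ 2"
  by (simp add: inner_vec_def sum_2)

lemma gradient_eqI:
  assumes "GDERIV f x :> D"
  shows "gradient f x = D"
  unfolding gradient_def
proof (rule the_equality)
  fix E assume "GDERIV f x :> E"
  then have "(\<lambda>h. h \<bullet> E) = (\<lambda>h. h \<bullet> D)"
    using assms unfolding gderiv_def by (rule has_derivative_unique)
  then show "E = D"
    by (metis inner_commute vector_eq_ldot)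
qed (fact assms)

lemma gradient_half_square_coord1:
  fixes x :: "real ^ 2"
  shows "gradient (\<lambda>x. \<beta> / 2 * (x $ 1)\<^sup>2) x = vector [\<beta> * x $ 1, 0]"
proof (rule gradient_eqI)
  have "((\<lambda>x :: real ^ 2. \<beta> / 2 * (x $ 1)\<^sup>2) has_derivative
      (\<lambda>h. \<beta> / 2 * (2 * x $ 1 * h $ 1))) (at x)"
    by (auto intro!: derivative_eq_intros bounded_linear.has_derivative[OF bounded_linear_vec_nth]
        simp: algebra_simps)
  then show "GDERIV (\<lambda>x. \<beta> / 2 * (x $ 1)\<^sup>2) x :> vector [\<beta> * x $ 1, 0]"
    by (simp add: gderiv_def inner_vec2 vector_2 algebra_simps)
qed

lemma conjugate_half_square_coord1:
  fixes y :: "real ^ 2"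
  assumes "\<beta> > 0"
  shows "conjugate (\<lambda>x. ereal (\<beta> / 2 * (x $ 1)\<^sup>2)) y =
    (if y $ 2 = 0 then ereal ((y $ 1)\<^sup>2 / (2 * \<beta>)) else \<infinity>)"
proof (cases "y $ 2 = 0")
  case True
  have le: "y $ 1 * t - \<beta> / 2 * t\<^sup>2 \<le> (y $ 1)\<^sup>2 / (2 * \<beta>)" for t
  proof -
    have "(y $ 1)\<^sup>2 / (2 * \<beta>) - (y $ 1 * t - \<beta> / 2 * t\<^sup>2) = (y $ 1 - \<beta> * t)\<^sup>2 / (2 * \<beta>)"
      using assms by (simp add: field_simps power2_eq_square)
    moreover have "(y $ 1 - \<beta> * t)\<^sup>2 / (2 * \<beta>) \<ge> 0"
      using assms by simp
    ultimately show ?thesis by linarith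
  qed
  \<comment> \<open>The supremum is attained where \<open>y\<close> is the gradient.\<close>
  have "conjugate (\<lambda>x. ereal (\<beta> / 2 * (x $ 1)\<^sup>2)) y = ereal ((y $ 1)\<^sup>2 / (2 * \<beta>))"
    unfolding conjugate_def
  proof (rule antisym)
    show "(SUP x. ereal (y \<bullet> x) - ereal (\<beta> / 2 * (x $ 1)\<^sup>2)) \<le> ereal ((y $ 1)\<^sup>2 / (2 * \<beta>))"
      using le True by (intro SUP_least) (simp add: inner_vec2)
    show "ereal ((y $ 1)\<^sup>2 / (2 * \<beta>)) \<le> (SUP x. ereal (y \<bullet> x) - ereal (\<beta> / 2 * (x $ 1)\<^sup>2))"
      using assms True
      by (intro SUP_upper2[where i = "vector [y $ 1 / \<beta>, 0]"])
        (simp_all add: inner_vec2 vector_2 field_simps power2_eq_square)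
  qed
  with True show ?thesis by simp
next
  case False
  \<comment> \<open>Along the second axis \<open>f\<close> vanishes, and the linear term is unbounded.\<close>
  have "conjugate (\<lambda>x. ereal (\<beta> / 2 * (x $ 1)\<^sup>2)) y = \<infinity>"
    unfolding conjugate_def
  proof (rule ereal_top)
    fix B :: real
    show "ereal B \<le> (SUP x. ereal (y \<bullet> x) - ereal (\<beta> / 2 * (x $ 1)\<^sup>2))"
      using False
      by (intro SUP_upper2[where i = "vector [0, B / y $ 2]"])
        (simp_all add: inner_vec2 vector_2)
  qed
  with False show ?thesis by simp
qed

lemma subdifferential_conjugate_half_square_coord1:
  fixes p :: "real ^ 2"
  assumes "\<beta> > 0"
  shows "u \<in> subdifferential (conjugate (\<lambda>x. ereal (\<beta> / 2 * (x $ 1)\<^sup>2))) p \<longleftrightarrow>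
    p $ 2 = 0 \<and> p $ 1 = \<beta> * u $ 1"
    (is "?L \<longleftrightarrow> ?R")
proof
  assume L: ?L
  have p2: "p $ 2 = 0"
  proof (rule ccontr)
    assume "p $ 2 \<noteq> 0"
    moreover from L have "conjugate (\<lambda>x. ereal (\<beta> / 2 * (x $ 1)\<^sup>2)) p + ereal (u \<bullet> (0 - p)) \<le>
        conjugate (\<lambda>x. ereal (\<beta> / 2 * (x $ 1)\<^sup>2)) (0 :: real ^ 2)"
      unfolding subdifferential_def mem_Collect_eq by (rule spec)
    ultimately show False
      unfolding conjugate_half_square_coord1[OF assms] by simp
  qed
  \<comment> \<open>Testing the inequality at the point whose derivative is \<open>u\<^sub>1\<close> leaves a square.\<close>
  have "(p $ 1)\<^sup>2 / (2 * \<beta>) + u $ 1 * (\<beta> * u $ 1 - p $ 1) \<le> (\<beta> * u $ 1)\<^sup>2 / (2 * \<beta>)"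
    using L p2 unfolding subdifferential_def conjugate_half_square_coord1[OF assms]
    by (auto dest!: spec[where x = "vector [\<beta> * u $ 1, 0]"] simp: inner_vec2 vector_2)
  then have "(p $ 1 - \<beta> * u $ 1)\<^sup>2 \<le> 0"
    using assms by (simp add: field_simps power2_eq_square)
  with p2 show ?R by simp
next
  assume R: ?R
  have "(p $ 1)\<^sup>2 / (2 * \<beta>) + u $ 1 * (t - p $ 1) \<le> t\<^sup>2 / (2 * \<beta>)" for t
  proof -
    have "t\<^sup>2 / (2 * \<beta>) - ((p $ 1)\<^sup>2 / (2 * \<beta>) + u $ 1 * (t - p $ 1)) = (t - p $ 1)\<^sup>2 / (2 * \<beta>)"
      using assms R by (simp add: field_simps power2_eq_square)
    moreover have "(t - p $ 1)\<^sup>2 / (2 * \<beta>) \<ge> 0"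
      using assms by simp
    ultimately show ?thesis by linarith
  qed
  with R show ?L
    unfolding subdifferential_def conjugate_half_square_coord1[OF assms]
    by (auto simp: inner_vec2)
qed

lemma resolvent_eqI:
  assumes "\<And>q. (\<exists>u\<in>M q. z = q + u) \<longleftrightarrow> q = p"
  shows "resolvent M z = p"
proof -
  have "q \<in> inverse_op (id_plus_op M) z \<longleftrightarrow> q = p" for q
    using assms[of q] by (auto simp: inverse_op_def id_plus_op_def)
  then show ?thesis by (simp add: resolvent_def)
qed

lemma reflected_resolvent_gradient:
  fixes z :: "real ^ 2"
  assumes "\<beta> > 0" "\<gamma> > 0"
  shows "reflected_resolvent (scale_op \<gamma> (\<lambda>x. {gradient (\<lambda>x. \<beta> / 2 * (x $ 1)\<^sup>2) x})) z =
    vector [(1 - \<gamma> * \<beta>) / (1 + \<gamma> * \<beta>) * z $ 1, z $ 2]"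
proof -
  have pos: "1 + \<gamma> * \<beta> > 0"
    using assms by (simp add: add_pos_pos)
  have "resolvent (scale_op \<gamma> (\<lambda>x. {gradient (\<lambda>x. \<beta> / 2 * (x $ 1)\<^sup>2) x})) z =
      vector [z $ 1 / (1 + \<gamma> * \<beta>), z $ 2]"
    unfolding gradient_half_square_coord1
  proof (rule resolvent_eqI)
    fix q :: "real ^ 2"
    have "(\<exists>u\<in>scale_op \<gamma> (\<lambda>x. {vector [\<beta> * x $ 1, 0]}) q. z = q + u) \<longleftrightarrow>
        z = q + \<gamma> *\<^sub>R vector [\<beta> * q $ 1, 0]"
      by (simp add: scale_op_def)
    also have "\<dots> \<longleftrightarrow> q = vector [z $ 1 / (1 + \<gamma> * \<beta>), z $ 2]"
      using pos by (auto simp: vec2_eq_iff vector_2 field_simps)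
    finally show "(\<exists>u\<in>scale_op \<gamma> (\<lambda>x. {vector [\<beta> * x $ 1, 0]}) q. z = q + u) \<longleftrightarrow>
        q = vector [z $ 1 / (1 + \<gamma> * \<beta>), z $ 2]" .
  qed
  then show ?thesis
    using pos by (simp add: reflected_resolvent_def vec2_eq_iff vector_2 field_simps)
qed

lemma reflected_resolvent_subdifferential_conjugate:
  fixes z :: "real ^ 2"
  assumes "\<beta> > 0" "\<gamma> > 0"
  shows "reflected_resolvent
      (scale_op \<gamma> (subdifferential (conjugate (\<lambda>x. ereal (\<beta> / 2 * (x $ 1)\<^sup>2))))) z =
    vector [(\<beta> - \<gamma>) / (\<beta> + \<gamma>) * z $ 1, - z $ 2]"
proof -
  let ?M = "scale_op \<gamma> (subdifferential (conjugate (\<lambda>x :: real ^ 2. ereal (\<beta> / 2 * (x $ 1)\<^sup>2))))"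
  have pos: "\<beta> + \<gamma> > 0"
    using assms by simp
  have "resolvent ?M z = vector [\<beta> * z $ 1 / (\<beta> + \<gamma>), 0]"
  proof (rule resolvent_eqI)
    fix q :: "real ^ 2"
    have "(\<exists>u\<in>?M q. z = q + u) \<longleftrightarrow>
        (\<exists>u. q $ 2 = 0 \<and> q $ 1 = \<beta> * u $ 1 \<and> z = q + \<gamma> *\<^sub>R u)"
      unfolding scale_op_def Bex_def image_iff
        subdifferential_conjugate_half_square_coord1[OF assms(1)]
      by blast
    also have "\<dots> \<longleftrightarrow> q $ 2 = 0 \<and> q $ 1 = \<beta> * ((z $ 1 - q $ 1) / \<gamma>)"
    proof
      assume "q $ 2 = 0 \<and> q $ 1 = \<beta> * ((z $ 1 - q $ 1) / \<gamma>)"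
      then show "\<exists>u. q $ 2 = 0 \<and> q $ 1 = \<beta> * u $ 1 \<and> z = q + \<gamma> *\<^sub>R u"
        using assms by (intro exI[where x = "(1 / \<gamma>) *\<^sub>R (z - q)"]) simp
    qed (use assms in auto)
    also have "\<dots> \<longleftrightarrow> q = vector [\<beta> * z $ 1 / (\<beta> + \<gamma>), 0]"
      using assms pos by (auto simp: vec2_eq_iff vector_2 field_simps)
    finally show "(\<exists>u\<in>?M q. z = q + u) \<longleftrightarrow> q = vector [\<beta> * z $ 1 / (\<beta> + \<gamma>), 0]" .
  qed
  then show ?thesis
    using pos by (simp add: reflected_resolvent_def vec2_eq_iff vector_2 field_simps)
qed

lemma DR_operator_second_axis:
  fixes x :: "real ^ 2"
  assumes "\<beta> > 0" "\<gamma> > 0" "x $ 1 = 0"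
  shows "DR_operator \<alpha> \<gamma> (subdifferential (conjugate (\<lambda>x. ereal (\<beta> / 2 * (x $ 1)\<^sup>2))))
      (\<lambda>x. {gradient (\<lambda>x. \<beta> / 2 * (x $ 1)\<^sup>2) x}) x = (1 - 2 * \<alpha>) *\<^sub>R x"
  unfolding DR_operator_def reflected_resolvent_gradient[OF assms(1,2)]
    reflected_resolvent_subdifferential_conjugate[OF assms(1,2)]
  using assms(3) by (simp add: vec2_eq_iff vector_2 algebra_simps)

lemma converges_exactly_with_rate_of_scaling:
  fixes z :: "nat \<Rightarrow> 'a::real_normed_vector"
  assumes "T 0 = 0" "\<And>k. z (Suc k) = r *\<^sub>R z k" "\<bar>r\<bar> < 1"
  shows "converges_exactly_with_rate T z \<bar>r\<bar>"
proof -
  have "z k = r ^ k *\<^sub>R z 0" for k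
    by (induction k) (simp_all add: assms(2))
  then have "z = (\<lambda>k. r ^ k *\<^sub>R z 0)" by (rule ext)
  moreover have "(\<lambda>k. r ^ k *\<^sub>R z 0) \<longlonglongrightarrow> 0 *\<^sub>R z 0"
    using assms(3) by (intro tendsto_intros LIMSEQ_power_zero) simp
  ultimately have "z \<longlonglongrightarrow> 0"
    by (metis scaleR_zero_left)
  then show ?thesis
    unfolding converges_exactly_with_rate_def using assms by (intro exI[where x = 0]) simp
qed

lemma rate_eq:
  fixes \<alpha> \<beta> \<gamma> \<sigma> c :: real
  defines "q \<equiv> (1 / (\<gamma> * \<sigma>) + \<gamma> * \<beta>) / (1 + 1 / (\<gamma> * \<sigma>) + \<gamma> * \<beta>)"
  assumes "\<beta> > 0" "\<gamma> > 0" "\<sigma> > 0"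
    and c: "c = (1 + \<gamma> * \<sigma> + \<gamma>\<^sup>2 * \<sigma> * \<beta>) / (1 + 2 * \<gamma> * \<sigma> + \<gamma>\<^sup>2 * \<sigma> * \<beta>)"
    and "c \<le> \<alpha>"
  shows "1 / 2 < \<alpha>" and "\<bar>1 - 2 * \<alpha> + \<alpha> * q\<bar> + \<alpha> * q = \<bar>1 - 2 * \<alpha>\<bar>"
proof -
  define s w where "s = \<gamma> * \<sigma>" and "w = \<gamma>\<^sup>2 * \<sigma> * \<beta>"
  have pos: "s > 0" "w > 0"
    using assms by (simp_all add: s_def w_def)
  have q: "q = (1 + w) / (1 + s + w)"
  proof -
    have "\<gamma> * \<beta> = w / s"
      using assms by (simp add: s_def w_def power2_eq_square)
    then have "q = (1 / s + w / s) / (1 + 1 / s + w / s)"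
      by (simp add: q_def s_def)
    also have "\<dots> = ((1 + w) / s) / ((1 + s + w) / s)"
      using pos by (simp add: field_simps)
    finally show ?thesis
      using pos by simp
  qed
  have cs: "c = (1 + s + w) / (1 + 2 * s + w)"
    by (simp add: c s_def w_def algebra_simps)
  have "1 / 2 < c"
    using pos by (simp add: cs field_simps)
  then show half: "1 / 2 < \<alpha>"
    using \<open>c \<le> \<alpha>\<close> by (rule less_le_trans)
  have "1 + s + w \<le> \<alpha> * (1 + 2 * s + w)"
    using \<open>c \<le> \<alpha>\<close> pos by (simp add: cs pos_divide_le_eq)
  moreover have "1 - 2 * \<alpha> + \<alpha> * q = (1 + s + w - \<alpha> * (1 + 2 * s + w)) / (1 + s + w)"
    using pos by (simp add: q field_simps)
  ultimately have "1 - 2 * \<alpha> + \<alpha> * q \<le> 0"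
    using pos by (simp add: divide_nonpos_pos)
  with half show "\<bar>1 - 2 * \<alpha> + \<alpha> * q\<bar> + \<alpha> * q = \<bar>1 - 2 * \<alpha>\<bar>"
    by linarith
qed

theorem proposition5p7:
  fixes \<alpha> \<beta> \<gamma> \<sigma> c z02 :: real
    and f :: "real ^ 2 \<Rightarrow> real"
    and A B :: "real ^ 2 \<Rightarrow> (real ^ 2) set"
    and z :: "nat \<Rightarrow> real ^ 2"
  assumes "\<beta> > 0"
    and "f = (\<lambda>x. \<beta> / 2 * (x $ 1)\<^sup>2)"
    and "\<sigma> = 1 / \<beta>"
    and "A = subdifferential (conjugate (\<lambda>x. ereal (f x)))"
    and "B = (\<lambda>x. {gradient f x})"
    and "\<gamma> > 0"
    and "c = (1 + \<gamma> * \<sigma> + \<gamma>\<^sup>2 * \<sigma> * \<beta>) / (1 + 2 * \<gamma> * \<sigma> + \<gamma>\<^sup>2 * \<sigma> * \<beta>)"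
    and "\<alpha> \<in> {c..<1}"
    and "z02 \<noteq> 0"
    and "z 0 = vector [0, z02]"
    and "\<And>k. z (Suc k) = DR_operator \<alpha> \<gamma> A B (z k)"
  shows "converges_exactly_with_rate (DR_operator \<alpha> \<gamma> A B) z
    (\<bar>1 - 2 * \<alpha> + \<alpha> * ((1 / (\<gamma> * \<sigma>) + \<gamma> * \<beta>) / (1 + 1 / (\<gamma> * \<sigma>) + \<gamma> * \<beta>))\<bar>
     + \<alpha> * ((1 / (\<gamma> * \<sigma>) + \<gamma> * \<beta>) / (1 + 1 / (\<gamma> * \<sigma>) + \<gamma> * \<beta>)))"
proof -
  let ?T = "DR_operator \<alpha> \<gamma> A B"
  have T: "?T x = (1 - 2 * \<alpha>) *\<^sub>R x" if "x $ 1 = 0" for x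
    using DR_operator_second_axis[OF assms(1,6) that] by (simp add: assms(2,4,5))
  have axis: "z k $ 1 = 0" for k
    by (induction k) (simp_all add: assms(10,11) T vector_2)
  have \<alpha>: "1 / 2 < \<alpha>" "\<alpha> < 1" and "c \<le> \<alpha>" and "\<sigma> > 0"
    using rate_eq(1)[OF assms(1,6) _ assms(7)] assms(1,3,8) by simp_all
  have "converges_exactly_with_rate ?T z \<bar>1 - 2 * \<alpha>\<bar>"
    using \<alpha> by (intro converges_exactly_with_rate_of_scaling) (auto simp: T axis assms(11))
  then show ?thesis
    by (simp only: rate_eq(2)[OF assms(1,6) \<open>\<sigma> > 0\<close> assms(7) \<open>c \<le> \<alpha>\<close>])
qed

end
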